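(* Let $\Omega\subset\mathbb{C}^n$ be the open unit ball with respect to some norm on $\mathbb{C}^n$, let $\mathbb{H}$ be a separable complex Hilbert space, and let $T=(T_1,\ldots,T_n)$ be a tuple of bounded operators on $\mathbb{H}$. Let $\rho_T:H^\infty(\Omega)\to\mathcal{B}(\mathbb{H}\oplus\mathbb{H})$ be the Parrott homomorphism \[\rho_T(f)=\begin{pmatrix} f(0)I & Df(0)\cdot T\\ 0 & f(0)I\end{pmatrix}.\] Then \[\sup\{\|\rho_T(\ell)\| : \ell\in\mathcal{L}[Z_1,\ldots,Z_n],\ \|\ell\|_{\Omega,\infty}\le 1\}=\sup\{\|\rho_T(f)\| : f\in H^\infty_0(\Omega,\mathbb{D})\}.\]
   Context: $H^\infty(\Omega)$ is the algebra of bounded holomorphic functions on $\Omega$, $\|f\|_{\Omega,\infty}=\sup_{z\in\Omega}|f(z)|$, and $H^\infty_0(\Omega,\mathbb{D})=\{f\in H^\infty(\Omega):\|f\|_{\Omega,\infty}\le 1,\ f(0)=0\}$. $\mathcal{L}[Z_1,\ldots,Z_n]=\{a_1z_1+\cdots+a_nz_n : a_i\in\mathbb{C}\}$. $Df(0)\cdot T=\sum_{i=1}^n\frac{\partial f}{\partial z_i}(0)T_i$. *)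

theory Defs
  imports "HOL-Analysis.Analysis"
begin

text \<open>The inner product is linear in its first argument.\<close>

class complex_hilbert_space = banach +
  fixes scaleC :: "complex \<Rightarrow> 'a \<Rightarrow> 'a"  (infixr \<open>*\<^sub>C\<close> 75)
    and cinner :: "'a \<Rightarrow> 'a \<Rightarrow> complex"
  assumes scaleC_add_right: "c *\<^sub>C (x + y) = c *\<^sub>C x + c *\<^sub>C y"
    and scaleC_add_left: "(c + d) *\<^sub>C x = c *\<^sub>C x + d *\<^sub>C x"
    and scaleC_scaleC: "c *\<^sub>C d *\<^sub>C x = (c * d) *\<^sub>C x"
    and scaleR_scaleC: "r *\<^sub>R x = complex_of_real r *\<^sub>C x"
    and cinner_commute: "cinner x y = cnj (cinner y x)"
    and cinner_add_left: "cinner (x + y) z = cinner x z + cinner y z"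
    and cinner_scaleC_left: "cinner (c *\<^sub>C x) y = c * cinner x y"
    and norm_eq_sqrt_cinner: "norm x = sqrt (Re (cinner x x))"

lemma Re_cinner_self: "Re (cinner x x) = (norm x)\<^sup>2"
  for x :: "'a::complex_hilbert_space"
  using norm_ge_zero[of x] by (simp add: norm_eq_sqrt_cinner)

text \<open>Positive definiteness is a consequence of the last axiom, as the norm is a norm.\<close>

lemma cinner_self: "cinner x x = complex_of_real ((norm x)\<^sup>2)"
  for x :: "'a::complex_hilbert_space"
proof -
  have "Im (cinner x x) = 0"
    using arg_cong[OF cinner_commute[of x x], of Im] by simp
  then show ?thesis
    by (simp add: complex_eq_iff Re_cinner_self)
qed

lemma scaleC_one: "1 *\<^sub>C x = x"
  using scaleR_scaleC[of 1 x] by simp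

lemma norm_scaleC: "norm (c *\<^sub>C x) = cmod c * norm x"
proof -
  have "cinner (c *\<^sub>C x) (c *\<^sub>C x) = c * cnj (cinner (c *\<^sub>C x) x)"
    by (metis cinner_scaleC_left cinner_commute)
  also have "\<dots> = (c * cnj c) * complex_of_real ((norm x)\<^sup>2)"
    by (simp add: cinner_scaleC_left cinner_self)
  also have "\<dots> = complex_of_real ((cmod c * norm x)\<^sup>2)"
    by (simp only: complex_norm_square[symmetric] power_mult_distrib of_real_mult)
  finally have "norm (c *\<^sub>C x) = sqrt ((cmod c * norm x)\<^sup>2)"
    unfolding norm_eq_sqrt_cinner[of "c *\<^sub>C x"] by (simp del: real_sqrt_abs)
  then show ?thesis by simp
qed

instantiation complex :: complex_hilbert_space
begin

definition scaleC_complex :: "complex \<Rightarrow> complex \<Rightarrow> complex"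
  where "scaleC_complex c x = c * x"

definition cinner_complex :: "complex \<Rightarrow> complex \<Rightarrow> complex"
  where "cinner_complex x y = x * cnj y"

instance
  by standard (auto simp: scaleC_complex_def cinner_complex_def algebra_simps scaleR_conv_of_real
      cmod_def power2_eq_square)

end

text \<open>The Hilbert space direct sum: the library norm on the product type is
  \<open>norm (x, y) = sqrt ((norm x)\<^sup>2 + (norm y)\<^sup>2)\<close>.\<close>

instantiation prod :: (complex_hilbert_space, complex_hilbert_space) complex_hilbert_space
begin

definition scaleC_prod :: "complex \<Rightarrow> 'a \<times> 'b \<Rightarrow> 'a \<times> 'b"
  where "scaleC_prod c p = (c *\<^sub>C fst p, c *\<^sub>C snd p)"

definition cinner_prod :: "'a \<times> 'b \<Rightarrow> 'a \<times> 'b \<Rightarrow> complex"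
  where "cinner_prod p q = cinner (fst p) (fst q) + cinner (snd p) (snd q)"

instance
proof
  fix p q r :: "'a \<times> 'b" and c d :: complex and t :: real
  show "c *\<^sub>C (p + q) = c *\<^sub>C p + c *\<^sub>C q" "(c + d) *\<^sub>C p = c *\<^sub>C p + d *\<^sub>C p"
    "c *\<^sub>C d *\<^sub>C p = (c * d) *\<^sub>C p" "t *\<^sub>R p = complex_of_real t *\<^sub>C p"
    by (auto simp: scaleC_prod_def scaleC_add_right scaleC_add_left scaleC_scaleC scaleR_scaleC
        prod_eq_iff)
  show "cinner p q = cnj (cinner q p)"
    unfolding cinner_prod_def
    by (simp add: cinner_commute[of "fst p" "fst q"] cinner_commute[of "snd p" "snd q"])
  show "cinner (p + q) r = cinner p r + cinner q r" "cinner (c *\<^sub>C p) q = c * cinner p q"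
    by (auto simp: cinner_prod_def scaleC_prod_def cinner_add_left cinner_scaleC_left algebra_simps)
  show "norm p = sqrt (Re (cinner p p))"
    by (simp add: cinner_prod_def norm_prod_def Re_cinner_self)
qed

end

definition bounded_clinear :: "('a::complex_hilbert_space \<Rightarrow> 'b::complex_hilbert_space) \<Rightarrow> bool"
  where "bounded_clinear A \<longleftrightarrow> bounded_linear A \<and> (\<forall>c x. A (c *\<^sub>C x) = c *\<^sub>C A x)"

definition is_complex_norm :: "(complex ^ 'n \<Rightarrow> real) \<Rightarrow> bool"
  where "is_complex_norm N \<longleftrightarrow>
    (\<forall>z. 0 \<le> N z) \<and> (\<forall>z. N z = 0 \<longleftrightarrow> z = 0) \<and>
    (\<forall>c z. N (c *s z) = cmod c * N z) \<and> (\<forall>z w. N (z + w) \<le> N z + N w)"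

text \<open>A function on a domain is represented by a function on all of \<open>\<complex>\<^sup>n\<close>, whose values outside
  the (open) domain are irrelevant.  Holomorphic means complex Frechet differentiable at each
  point of the domain.\<close>

definition holomorphic_mv :: "(complex ^ 'n \<Rightarrow> complex) \<Rightarrow> (complex ^ 'n) set \<Rightarrow> bool"
  where "holomorphic_mv f \<Omega> \<longleftrightarrow>
    (\<forall>z\<in>\<Omega>. \<exists>f'. (f has_derivative f') (at z) \<and> (\<forall>c v. f' (c *s v) = c * f' v))"

definition H_inf :: "(complex ^ 'n) set \<Rightarrow> (complex ^ 'n \<Rightarrow> complex) set"
  where "H_inf \<Omega> = {f. holomorphic_mv f \<Omega> \<and> bounded (f ` \<Omega>)}"

definition sup_norm_on :: "(complex ^ 'n) set \<Rightarrow> (complex ^ 'n \<Rightarrow> complex) \<Rightarrow> real"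
  where "sup_norm_on \<Omega> f = (SUP z\<in>\<Omega>. cmod (f z))"

definition H_inf_0 :: "(complex ^ 'n) set \<Rightarrow> (complex ^ 'n \<Rightarrow> complex) set"
  where "H_inf_0 \<Omega> = {f \<in> H_inf \<Omega>. sup_norm_on \<Omega> f \<le> 1 \<and> f 0 = 0}"

definition linear_forms :: "(complex ^ 'n \<Rightarrow> complex) set"
  where "linear_forms = {l. \<exists>a. l = (\<lambda>z. \<Sum>i\<in>UNIV. a i * z $ i)}"

definition partial_deriv :: "'n \<Rightarrow> (complex ^ 'n \<Rightarrow> complex) \<Rightarrow> complex ^ 'n \<Rightarrow> complex"
  where "partial_deriv i f z = deriv (\<lambda>w. f (z + axis i w)) 0"

definition D0_dot ::
    "(complex ^ 'n \<Rightarrow> complex) \<Rightarrow> ('n \<Rightarrow> 'h \<Rightarrow> 'h) \<Rightarrow> 'h \<Rightarrow> 'h::complex_hilbert_space"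
  where "D0_dot f T x = (\<Sum>i\<in>UNIV. partial_deriv i f 0 *\<^sub>C T i x)"

definition parrott ::
    "('n \<Rightarrow> 'h \<Rightarrow> 'h) \<Rightarrow> (complex ^ 'n \<Rightarrow> complex) \<Rightarrow> 'h \<times> 'h \<Rightarrow> 'h \<times> 'h::complex_hilbert_space"
  where "parrott T f = (\<lambda>(x, y). (f 0 *\<^sub>C x + D0_dot f T y, f 0 *\<^sub>C y))"

lemma bounded_clinear_scaleC: "bounded_clinear A \<Longrightarrow> bounded_clinear (\<lambda>x. c *\<^sub>C A x)"
  for A :: "'a::complex_hilbert_space \<Rightarrow> 'b::complex_hilbert_space"
proof -
  assume A: "bounded_clinear A"
  have "bounded_linear (\<lambda>y::'b. c *\<^sub>C y)"
    by (rule bounded_linear_intro[where K = "cmod c"])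
      (simp_all add: scaleC_add_right scaleR_scaleC scaleC_scaleC norm_scaleC mult.commute)
  with A show ?thesis
    unfolding bounded_clinear_def
    by (auto simp: scaleC_scaleC mult.commute intro: bounded_linear_compose)
qed

lemma bounded_clinear_add:
  "bounded_clinear A \<Longrightarrow> bounded_clinear B \<Longrightarrow> bounded_clinear (\<lambda>x. A x + B x)"
  unfolding bounded_clinear_def by (auto simp: scaleC_add_right intro: bounded_linear_add)

lemma bounded_clinear_sum:
  "finite I \<Longrightarrow> (\<And>i. i \<in> I \<Longrightarrow> bounded_clinear (A i)) \<Longrightarrow> bounded_clinear (\<lambda>x. \<Sum>i\<in>I. A i x)"
proof (induction I rule: finite_induct)
  case empty
  have "c *\<^sub>C (0::'c::complex_hilbert_space) = 0" for c
    using scaleC_add_right[of c "0::'c" 0] by simp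
  then show ?case
    by (simp add: bounded_clinear_def)
next
  case (insert i I)
  then show ?case
    by (simp add: bounded_clinear_add)
qed

lemma bounded_clinear_parrott:
  fixes T :: "'n::finite \<Rightarrow> 'b \<Rightarrow> 'b::complex_hilbert_space"
  assumes "\<And>i. bounded_clinear (T i)"
  shows "bounded_clinear (parrott T f)"
proof -
  have fs: "bounded_clinear (fst :: 'b \<times> 'b \<Rightarrow> 'b)" "bounded_clinear (snd :: 'b \<times> 'b \<Rightarrow> 'b)"
    by (simp_all add: bounded_clinear_def bounded_linear_fst bounded_linear_snd scaleC_prod_def)
  have T: "bounded_clinear (\<lambda>p :: 'b \<times> 'b. T i (snd p))" for i
    using assms[of i] fs(2) unfolding bounded_clinear_def
    by (auto intro: bounded_linear_compose)
  have D: "bounded_clinear (\<lambda>p :: 'b \<times> 'b. D0_dot f T (snd p))"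
    unfolding D0_dot_def by (intro bounded_clinear_sum bounded_clinear_scaleC T) simp
  have "bounded_clinear (\<lambda>p. (f 0 *\<^sub>C fst p + D0_dot f T (snd p), f 0 *\<^sub>C snd p))"
    using bounded_clinear_add[OF bounded_clinear_scaleC[OF fs(1), of "f 0"] D]
      bounded_clinear_scaleC[OF fs(2), of "f 0"]
    unfolding bounded_clinear_def by (auto simp: scaleC_prod_def intro: bounded_linear_Pair)
  then show ?thesis
    by (simp add: parrott_def case_prod_beta')
qed

end

theory Submission
  imports Defs "HOL-Complex_Analysis.Cauchy_Integral_Formula"
begin

text \<open>
  Both suprema range over the same set of operators.  When \<open>f 0 = 0\<close>, the operator
  \<open>parrott T f\<close> depends on \<open>f\<close> only through the partial derivatives at the origin, hence coincides
  with \<open>parrott T l\<close> for the linear form \<open>l = Df(0)\<close>.  The Schwarz lemma keeps \<open>l\<close> in the unit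
  ball: for \<open>z \<in> \<Omega>\<close> the slice \<open>w \<mapsto> f (w z)\<close> maps the closed unit disc into itself, because \<open>\<Omega>\<close>
  is balanced, and its derivative at \<open>0\<close> is \<open>l z\<close>; so Cauchy's inequality gives \<open>\<bar>l z\<bar> \<le> 1\<close>
  (\<open>derivative_at_0_bound\<close>).  Conversely a linear form of supremum norm at most \<open>1\<close> is itself a
  competitor on the right, once it is known to be bounded on \<open>\<Omega>\<close>, which holds because all norms on
  \<open>\<complex>\<^sup>n\<close> are equivalent (\<open>complex_norm_lower_bound\<close>).
\<close>

lemma of_real_scale_vec: "complex_of_real r *s z = r *\<^sub>R z"
  by (simp only: vec_eq_iff vector_smult_component vector_scaleR_component)
    (simp add: scaleR_conv_of_real)

text \<open>A convex function on a finite-dimensional space is continuous, so \<open>N\<close> attains a positive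
  minimum on the Euclidean unit sphere.\<close>

lemma complex_norm_lower_bound:
  fixes N :: "complex ^ 'n \<Rightarrow> real"
  assumes N: "is_complex_norm N"
  obtains c where "c > 0" "\<And>z. c * norm z \<le> N z"
proof -
  have scaleR: "N (r *\<^sub>R z) = \<bar>r\<bar> * N z" for r z
    using N unfolding is_complex_norm_def of_real_scale_vec[symmetric] by simp
  have "convex_on UNIV N"
  proof (rule convex_onI)
    fix t :: real and x y :: "complex ^ 'n"
    assume "0 < t" "t < 1"
    moreover have "N ((1 - t) *\<^sub>R x + t *\<^sub>R y) \<le> N ((1 - t) *\<^sub>R x) + N (t *\<^sub>R y)"
      using N by (simp add: is_complex_norm_def)
    ultimately show "N ((1 - t) *\<^sub>R x + t *\<^sub>R y) \<le> (1 - t) * N x + t * N y"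
      by (simp add: scaleR)
  qed simp
  then have "continuous_on UNIV N"
    by (intro convex_on_continuous) auto
  then have "continuous_on (sphere 0 1) N"
    using continuous_on_subset by blast
  then have "\<exists>u\<in>sphere 0 1. \<forall>z\<in>sphere 0 1. N u \<le> N z"
    by (intro continuous_attains_inf) simp_all
  then obtain u where u: "u \<in> sphere 0 1" "\<And>z. z \<in> sphere 0 1 \<Longrightarrow> N u \<le> N z"
    by blast
  show thesis
  proof
    show "N u > 0"
      using u(1) N by (auto simp: is_complex_norm_def order_less_le)
    show "N u * norm z \<le> N z" for z
    proof (cases "z = 0")
      case False
      then have "N u \<le> N ((1 / norm z) *\<^sub>R z)"
        by (intro u(2)) simp
      with False show ?thesis
        by (simp add: scaleR field_simps)
    qed (use N in \<open>simp add: is_complex_norm_def\<close>)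
  qed
qed

lemma bounded_linear_linear_form:
  "bounded_linear (\<lambda>z :: complex ^ 'n. \<Sum>i\<in>UNIV. a i * z $ i)"
  by (intro bounded_linear_sum bounded_linear_const_mult bounded_linear_vec_nth)

text \<open>A bound on \<open>sup_norm_on\<close> does not by itself make a function bounded, the supremum of an
  unbounded set of reals being unspecified.  Linear forms are bounded because the ball is.\<close>

lemma linear_form_in_H_inf:
  assumes N: "is_complex_norm N" and l: "l \<in> linear_forms"
  shows "l \<in> H_inf {z. N z < 1}"
proof -
  obtain a where a: "l = (\<lambda>z. \<Sum>i\<in>UNIV. a i * z $ i)"
    using l by (auto simp: linear_forms_def)
  have bl: "bounded_linear l"
    unfolding a by (rule bounded_linear_linear_form)
  have "l (c *s v) = c * l v" for c v
    by (simp add: a sum_distrib_left algebra_simps)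
  then have hol: "holomorphic_mv l {z. N z < 1}"
    unfolding holomorphic_mv_def using bounded_linear_imp_has_derivative[OF bl] by blast
  obtain c where c: "c > 0" "\<And>z. c * norm z \<le> N z"
    using complex_norm_lower_bound[OF N] by blast
  have "norm z \<le> 1 / c" if "N z < 1" for z
    using c(1) c(2)[of z] that by (simp add: field_simps)
  then have "bounded {z. N z < 1}"
    unfolding bounded_iff by blast
  then show ?thesis
    using hol bounded_linear_image[OF _ bl] by (simp add: H_inf_def)
qed

lemma has_field_derivative_slice:
  fixes f :: "complex ^ 'n \<Rightarrow> complex"
  assumes "(f has_derivative f') (at (w *s z))" and "\<And>c v. f' (c *s v) = c * f' v"
  shows "((\<lambda>w. f (w *s z)) has_field_derivative f' z) (at w)"
proof -
  have "bounded_linear (\<lambda>w. w *s z)"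
    by (rule linear_conv_bounded_linear[THEN iffD1], rule linearI)
       (simp_all add: vec_eq_iff algebra_simps)
  then have "((\<lambda>w. w *s z) has_derivative (\<lambda>w. w *s z)) (at w)"
    by (rule bounded_linear_imp_has_derivative)
  from has_derivative_compose[OF this assms(1)] show ?thesis
    by (simp only: assms(2) has_field_derivative_def mult.commute[of _ "f' z"])
qed

lemma partial_deriv_eq:
  fixes f :: "complex ^ 'n \<Rightarrow> complex"
  assumes "(f has_derivative f') (at 0)" and "\<And>c v. f' (c *s v) = c * f' v"
  shows "partial_deriv i f 0 = f' (axis i 1)"
proof -
  have "(\<lambda>w. f (0 + axis i w)) = (\<lambda>w. f (w *s axis i 1))"
    by (intro ext arg_cong[where f = f]) (simp add: vec_eq_iff axis_def)
  moreover have "((\<lambda>w. f (w *s axis i 1)) has_field_derivative f' (axis i 1)) (at 0)"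
    by (rule has_field_derivative_slice) (use assms in simp_all)
  ultimately show ?thesis
    unfolding partial_deriv_def by (simp only: DERIV_imp_deriv)
qed

lemma derivative_eq_sum_axis:
  fixes f' :: "complex ^ 'n \<Rightarrow> complex"
  assumes "linear f'" and "\<And>c v. f' (c *s v) = c * f' v"
  shows "f' z = (\<Sum>i\<in>UNIV. f' (axis i 1) * z $ i)"
proof -
  have "f' z = f' (\<Sum>i\<in>UNIV. z $ i *s axis i 1)"
    by (simp add: basis_expansion)
  also have "\<dots> = (\<Sum>i\<in>UNIV. f' (z $ i *s axis i 1))"
    by (rule linear_sum[OF assms(1)])
  finally show ?thesis
    by (simp add: assms(2) mult.commute)
qed

lemma cmod_le_1_of_H_inf_0:
  assumes "f \<in> H_inf_0 \<Omega>" and "z \<in> \<Omega>"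
  shows "cmod (f z) \<le> 1"
proof -
  have "bounded (f ` \<Omega>)"
    using assms(1) by (simp add: H_inf_0_def H_inf_def)
  then have "bdd_above ((\<lambda>z. cmod (f z)) ` \<Omega>)"
    by (auto simp: bounded_iff intro: bdd_aboveI2)
  then have "cmod (f z) \<le> sup_norm_on \<Omega> f"
    unfolding sup_norm_on_def by (rule cSUP_upper[OF assms(2)])
  also have "\<dots> \<le> 1"
    using assms(1) by (simp add: H_inf_0_def)
  finally show ?thesis .
qed

text \<open>Since \<open>N z < 1\<close>, the slice \<open>w \<mapsto> f (w z)\<close> is holomorphic across the unit circle, so Cauchy's
  inequality on radius \<open>1\<close> yields the sharp constant without a limiting argument.\<close>

lemma derivative_at_0_bound:
  fixes N :: "complex ^ 'n \<Rightarrow> real"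
  assumes N: "is_complex_norm N" and f: "f \<in> H_inf_0 {z. N z < 1}"
    and f': "(f has_derivative f') (at 0)" "\<And>c v. f' (c *s v) = c * f' v"
    and z: "N z < 1"
  shows "cmod (f' z) \<le> 1"
proof -
  define g where "g = (\<lambda>w. f (w *s z))"
  have ball: "N (w *s z) < 1" if "w \<in> cball 0 1" for w
  proof -
    have "N (w *s z) = cmod w * N z" "0 \<le> N z"
      using N by (simp_all add: is_complex_norm_def)
    moreover have "cmod w * N z \<le> 1 * N z"
      using that \<open>0 \<le> N z\<close> by (intro mult_right_mono) simp_all
    ultimately show ?thesis using z by simp
  qed
  have "g field_differentiable (at w)" if w: "w \<in> cball 0 1" for w
  proof -
    obtain F where "(f has_derivative F) (at (w *s z))" "\<And>c v. F (c *s v) = c * F v"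
      using f ball[OF w] by (auto simp: H_inf_0_def H_inf_def holomorphic_mv_def)
    from has_field_derivative_slice[OF this] show ?thesis
      unfolding g_def field_differentiable_def by blast
  qed
  then have hol: "g holomorphic_on cball 0 1"
    by (simp add: holomorphic_on_def field_differentiable_at_within)
  have "cmod ((deriv ^^ 1) g 0) \<le> fact 1 * 1 / 1 ^ 1"
  proof (rule Cauchy_inequality)
    show "g holomorphic_on ball 0 1"
      using hol ball_subset_cball by (rule holomorphic_on_subset)
    show "continuous_on (cball 0 1) g"
      using hol by (rule holomorphic_on_imp_continuous_on)
    show "cmod (g w) \<le> 1" if "cmod (0 - w) = 1" for w
      unfolding g_def using that by (intro cmod_le_1_of_H_inf_0[OF f]) (simp add: ball)
  qed simp
  moreover have "(g has_field_derivative f' z) (at 0)"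
    unfolding g_def by (rule has_field_derivative_slice) (use f' in simp_all)
  ultimately show ?thesis
    by (simp add: DERIV_imp_deriv)
qed

text \<open>The linear form is \<open>Df(0)\<close>: it agrees with \<open>f\<close> at the origin and is its own derivative there,
  and these data determine the Parrott operator.\<close>

lemma exists_linear_form_same_parrott:
  fixes N :: "complex ^ 'n \<Rightarrow> real" and T :: "'n \<Rightarrow> 'h \<Rightarrow> 'h::complex_hilbert_space"
  assumes N: "is_complex_norm N" and f: "f \<in> H_inf_0 {z. N z < 1}"
  shows "\<exists>l\<in>linear_forms. sup_norm_on {z. N z < 1} l \<le> 1 \<and> parrott T l = parrott T f"
proof -
  have "N 0 = 0"
    using N by (simp add: is_complex_norm_def)
  then have zero: "N 0 < 1"
    by simp
  then obtain f' where f': "(f has_derivative f') (at 0)" "\<And>c v. f' (c *s v) = c * f' v"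
    using f by (auto simp: H_inf_0_def H_inf_def holomorphic_mv_def)
  have bl: "bounded_linear f'"
    using f'(1) by (rule has_derivative_bounded_linear)
  have "f' = (\<lambda>z. \<Sum>i\<in>UNIV. f' (axis i 1) * z $ i)"
    using derivative_eq_sum_axis[OF bounded_linear.linear[OF bl] f'(2)] by blast
  then have "f' \<in> linear_forms"
    unfolding linear_forms_def by (intro CollectI exI[where x = "\<lambda>i. f' (axis i 1)"])
  moreover have "sup_norm_on {z. N z < 1} f' \<le> 1"
    unfolding sup_norm_on_def
    by (rule cSUP_least) (use zero derivative_at_0_bound[OF N f f'] in auto)
  moreover have "partial_deriv i f' 0 = partial_deriv i f 0" for i
    by (simp only: partial_deriv_eq[OF bounded_linear_imp_has_derivative[OF bl] f'(2)]
        partial_deriv_eq[OF f'])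
  moreover have "f' 0 = f 0"
    using f linear_simps(3)[OF bl] by (simp add: H_inf_0_def)
  ultimately show ?thesis
    by (intro bexI[where x = f']) (simp_all add: parrott_def D0_dot_def)
qed

theorem theorem1p3:
  fixes N :: "complex ^ 'n \<Rightarrow> real"
    and \<Omega> :: "(complex ^ 'n) set"
    and T :: "'n \<Rightarrow> 'h \<Rightarrow> 'h::complex_hilbert_space"
  assumes "is_complex_norm N"
    and "\<Omega> = {z. N z < 1}"
    and "separable_space (euclidean :: 'h topology)"
    and "\<And>i. bounded_clinear (T i)"
  shows "(SUP l \<in> {l \<in> linear_forms. sup_norm_on \<Omega> l \<le> 1}. onorm (parrott T l))
       = (SUP f \<in> H_inf_0 \<Omega>. onorm (parrott T f))"
proof -
  have "{l \<in> linear_forms. sup_norm_on \<Omega> l \<le> 1} \<subseteq> H_inf_0 \<Omega>"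
    using linear_form_in_H_inf[OF assms(1)] assms(2)
    by (auto simp: H_inf_0_def linear_forms_def)
  moreover have "parrott T f \<in> parrott T ` {l \<in> linear_forms. sup_norm_on \<Omega> l \<le> 1}"
    if f: "f \<in> H_inf_0 \<Omega>" for f
  proof -
    obtain l where "l \<in> linear_forms" "sup_norm_on \<Omega> l \<le> 1" "parrott T l = parrott T f"
      using exists_linear_form_same_parrott[OF assms(1) f[unfolded assms(2)]]
      unfolding assms(2) by blast
    then show ?thesis
      by (intro image_eqI[where x = l]) simp_all
  qed
  ultimately have "parrott T ` {l \<in> linear_forms. sup_norm_on \<Omega> l \<le> 1} = parrott T ` H_inf_0 \<Omega>"
    by (intro equalityI image_mono image_subsetI)
  then show ?thesis
    unfolding image_image[of onorm "parrott T", symmetric] by (rule arg_cong)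
qed

end
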